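(* The axioms (D1)-(D6) are sound and complete with respect to the class of induced four-valued probability functions of probabilistic models. That is: a function $\hat p:\mathcal{L}\to\mathbb{R}^4$ satisfies (D1)-(D6) if and only if there is a probabilistic model $\mathcal{M}=\langle\Sigma,\mu,v^+,v^-\rangle$ whose induced four-valued probability function $\hat p_\mu$ equals $\hat p$.
   Context: Let $\mathrm{Prop}$ be a fixed finite set of propositional variables and let $\mathcal{L}$ be the set of formulas generated by $\varphi::= p\mid\neg\varphi\mid\varphi\wedge\varphi$ with $p\in\mathrm{Prop}$; $\varphi\vee\psi$ abbreviates $\neg(\neg\varphi\wedge\neg\psi)$. Belnap-Dunn entailment: a double valuation is a pair of functions $v^+,v^-:\mathrm{Prop}\to\{0,1\}$ (arbitrary and independent of each other), extended to $\mathcal{L}$ by: $v^+(\neg\varphi)=1$ iff $v^-(\varphi)=1$; $v^-(\neg\varphi)=1$ iff $v^+(\varphi)=1$; $v^+(\varphi\wedge\psi)=1$ iff $v^+(\varphi)=1$ and $v^+(\psi)=1$; $v^-(\varphi\wedge\psi)=1$ iff $v^-(\varphi)=1$ or $v^-(\psi)=1$. Write $\varphi\vDash_L\psi$ iff for all double valuations, $v^+(\varphi)=1$ implies $v^+(\psi)=1$. Axioms, writing $\hat p(\varphi)=(b_\varphi,d_\varphi,u_\varphi,c_\varphi)$, for all $\varphi,\psi\in\mathcal{L}$: (D1) $0\le b_\varphi,d_\varphi,u_\varphi,c_\varphi$; (D2) $b_\varphi+d_\varphi+u_\varphi+c_\varphi=1$; (D3) $b_{\neg\varphi}=d_\varphi$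 and $c_{\neg\varphi}=c_\varphi$; (D4) if $\varphi\vDash_L\psi$ then $b_\varphi+c_\varphi\le b_\psi+c_\psi$; (D5) $b_{\varphi\wedge\neg\varphi}=0$ and $c_{\varphi\wedge\neg\varphi}=c_\varphi$; (D6) $b_\varphi+c_\varphi+b_\psi+c_\psi=b_{\varphi\wedge\psi}+c_{\varphi\wedge\psi}+b_{\varphi\vee\psi}+c_{\varphi\vee\psi}$. A probabilistic model is a tuple $\langle\Sigma,\mu,v^+,v^-\rangle$ where $\Sigma$ is a finite or countably infinite set, $v^+,v^-:\Sigma\times\mathrm{Prop}\to\{0,1\}$ are arbitrary functions, and $\mu$ is a (classical) probability measure on the full power set of $\Sigma$. Relations $\models^+,\models^-$ between states $s\in\Sigma$ and formulas: $s\models^+p$ iff $v^+(s,p)=1$; $s\models^-p$ iff $v^-(s,p)=1$; $s\models^+\varphi\wedge\psi$ iff $s\models^+\varphi$ and $s\models^+\psi$; $s\models^-\varphi\wedge\psi$ iff $s\models^-\varphi$ or $s\models^-\psi$; $s\models^+\neg\varphi$ iff $s\models^-\varphi$; $s\models^-\neg\varphi$ iff $s\models^+\varphi$. Put $|\varphi|^{\pm}=\{s: s\models^{\pm}\varphi\}$. The induced four-valued probability function is $\hat p_\mu(\varphi)=(\mu(|\varphi|^+\setminus|\varphi|^-),\ \mu(|\varphi|^-\setminus|\varphi|^+),\ \mu(\Sigma\setminus(|\varphi|^+\cup|\varphi|^-)),\ \mu(|\varphi|^+\cap|\varphi|^-))$. *)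

theory Defs
  imports "HOL-Probability.Probability"
begin

datatype 'p fm = Atom 'p | Neg "'p fm" | Conj "'p fm" "'p fm"

abbreviation Disj :: "'p fm \<Rightarrow> 'p fm \<Rightarrow> 'p fm" where
  "Disj \<phi> \<psi> \<equiv> Neg (Conj (Neg \<phi>) (Neg \<psi>))"

text \<open>Extension of a double valuation \<open>(v, w)\<close>, with \<open>v\<close> for support of truth and \<open>w\<close> for
  support of falsity, to all formulas.\<close>

fun supp_true :: "('p \<Rightarrow> bool) \<Rightarrow> ('p \<Rightarrow> bool) \<Rightarrow> 'p fm \<Rightarrow> bool"
  and supp_false :: "('p \<Rightarrow> bool) \<Rightarrow> ('p \<Rightarrow> bool) \<Rightarrow> 'p fm \<Rightarrow> bool" where
  "supp_true v w (Atom p) \<longleftrightarrow> v p"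
| "supp_true v w (Neg \<phi>) \<longleftrightarrow> supp_false v w \<phi>"
| "supp_true v w (Conj \<phi> \<psi>) \<longleftrightarrow> supp_true v w \<phi> \<and> supp_true v w \<psi>"
| "supp_false v w (Atom p) \<longleftrightarrow> w p"
| "supp_false v w (Neg \<phi>) \<longleftrightarrow> supp_true v w \<phi>"
| "supp_false v w (Conj \<phi> \<psi>) \<longleftrightarrow> supp_false v w \<phi> \<or> supp_false v w \<psi>"

definition bd_entails :: "'p fm \<Rightarrow> 'p fm \<Rightarrow> bool" where
  "bd_entails \<phi> \<psi> \<longleftrightarrow> (\<forall>v w. supp_true v w \<phi> \<longrightarrow> supp_true v w \<psi>)"

type_synonym 'p four_fun = "'p fm \<Rightarrow> real \<times> real \<times> real \<times> real"

definition bel :: "'p four_fun \<Rightarrow> 'p fm \<Rightarrow> real" where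
  "bel P \<phi> = (case P \<phi> of (b, d, u, c) \<Rightarrow> b)"

definition disbel :: "'p four_fun \<Rightarrow> 'p fm \<Rightarrow> real" where
  "disbel P \<phi> = (case P \<phi> of (b, d, u, c) \<Rightarrow> d)"

definition uncert :: "'p four_fun \<Rightarrow> 'p fm \<Rightarrow> real" where
  "uncert P \<phi> = (case P \<phi> of (b, d, u, c) \<Rightarrow> u)"

definition conflict :: "'p four_fun \<Rightarrow> 'p fm \<Rightarrow> real" where
  "conflict P \<phi> = (case P \<phi> of (b, d, u, c) \<Rightarrow> c)"

definition four_valued_axioms :: "'p four_fun \<Rightarrow> bool" where
  "four_valued_axioms P \<longleftrightarrow>
     (\<forall>\<phi>. 0 \<le> bel P \<phi> \<and> 0 \<le> disbel P \<phi> \<and> 0 \<le> uncert P \<phi> \<and> 0 \<le> conflict P \<phi>) \<and>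
     (\<forall>\<phi>. bel P \<phi> + disbel P \<phi> + uncert P \<phi> + conflict P \<phi> = 1) \<and>
     (\<forall>\<phi>. bel P (Neg \<phi>) = disbel P \<phi> \<and> conflict P (Neg \<phi>) = conflict P \<phi>) \<and>
     (\<forall>\<phi> \<psi>. bd_entails \<phi> \<psi> \<longrightarrow> bel P \<phi> + conflict P \<phi> \<le> bel P \<psi> + conflict P \<psi>) \<and>
     (\<forall>\<phi>. bel P (Conj \<phi> (Neg \<phi>)) = 0 \<and> conflict P (Conj \<phi> (Neg \<phi>)) = conflict P \<phi>) \<and>
     (\<forall>\<phi> \<psi>. bel P \<phi> + conflict P \<phi> + bel P \<psi> + conflict P \<psi> =
        bel P (Conj \<phi> \<psi>) + conflict P (Conj \<phi> \<psi>) + bel P (Disj \<phi> \<psi>) + conflict P (Disj \<phi> \<psi>))"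

text \<open>The valuations are total on the type of states; only their values on \<open>states M\<close> are used.\<close>

record ('s, 'p) pmodel =
  states :: "'s set"
  pmeas :: "'s measure"
  vpos :: "'s \<Rightarrow> 'p \<Rightarrow> bool"
  vneg :: "'s \<Rightarrow> 'p \<Rightarrow> bool"

definition prob_model :: "('s, 'p) pmodel \<Rightarrow> bool" where
  "prob_model M \<longleftrightarrow> countable (states M) \<and> prob_space (pmeas M) \<and>
     space (pmeas M) = states M \<and> sets (pmeas M) = Pow (states M)"

definition ext_pos :: "('s, 'p) pmodel \<Rightarrow> 'p fm \<Rightarrow> 's set" where
  "ext_pos M \<phi> = {s \<in> states M. supp_true (vpos M s) (vneg M s) \<phi>}"

definition ext_neg :: "('s, 'p) pmodel \<Rightarrow> 'p fm \<Rightarrow> 's set" where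
  "ext_neg M \<phi> = {s \<in> states M. supp_false (vpos M s) (vneg M s) \<phi>}"

definition induced :: "('s, 'p) pmodel \<Rightarrow> 'p four_fun" where
  "induced M \<phi> =
     (measure (pmeas M) (ext_pos M \<phi> - ext_neg M \<phi>),
      measure (pmeas M) (ext_neg M \<phi> - ext_pos M \<phi>),
      measure (pmeas M) (states M - (ext_pos M \<phi> \<union> ext_neg M \<phi>)),
      measure (pmeas M) (ext_pos M \<phi> \<inter> ext_neg M \<phi>))"

text \<open>HOL cannot quantify existentially over types. The type \<open>nat\<close> hosts, up to bijection, every
  finite or countably infinite set of states, so existence statements about models use
  \<open>(nat, 'p) pmodel\<close>.\<close>

end

theory Submission
  imports Defs
begin

text \<open>
  Everything in \<^term>\<open>P\<close> is governed by the single function \<open>\<phi> \<mapsto> b + c\<close>, the probability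
  that \<open>\<phi>\<close> is supported as true: the analogous sum for \<open>\<not>\<phi>\<close> is \<open>d + c\<close>, the one for
  \<open>\<phi> \<and> \<not>\<phi>\<close> is \<open>c\<close>, and the four components add up to 1. In a model this function is the measure
  of the truth extension, which gives soundness: the axioms become monotonicity and modularity of
  a measure.

  For completeness, a double valuation is the same thing as a set of signed atoms, and the truth of
  a formula is preserved when such a set grows. The formulas therefore define up-sets in the finite
  Boolean lattice of states. Conversely, a conjunction of signed atoms defines a principal up-set
  and disjunctions give unions of these, so every up-set is definable except the empty one and the
  whole space, since the language has no constants (\<open>truth_set_onto\<close>). Put \<open>m(U) = b + c\<close> for any
  formula defining \<open>U\<close>, and add \<open>m({}) = 0\<close> and \<open>m(UNIV) = 1\<close>. By the axioms \<open>m\<close> is well defined,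
  monotone and modular on all up-sets.

  Such a function on the up-sets of a finite order comes from point masses: the mass of \<open>x\<close> has to be
  \<open>m({x..}) - m({x<..})\<close>, monotonicity makes it nonnegative, and modularity allows an up-set to be
  dismantled by removing minimal elements one at a time (\<open>modular_upset_sum\<close>). The resulting
  probability mass function on the states is the required model.
\<close>

section \<open>Soundness\<close>

abbreviation truth_prob :: "'p four_fun \<Rightarrow> 'p fm \<Rightarrow> real" where
  "truth_prob P \<phi> \<equiv> bel P \<phi> + conflict P \<phi>"

lemma ext_connectives:
  "ext_pos M (Neg \<phi>) = ext_neg M \<phi>"
  "ext_neg M (Neg \<phi>) = ext_pos M \<phi>"
  "ext_pos M (Conj \<phi> \<psi>) = ext_pos M \<phi> \<inter> ext_pos M \<psi>"
  "ext_neg M (Conj \<phi> \<psi>) = ext_neg M \<phi> \<union> ext_neg M \<psi>"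
  by (auto simp: ext_pos_def ext_neg_def)

lemma ext_subset_states: "ext_pos M \<phi> \<subseteq> states M" "ext_neg M \<phi> \<subseteq> states M"
  by (auto simp: ext_pos_def ext_neg_def)

lemma induced_components:
  "bel (induced M) \<phi> = measure (pmeas M) (ext_pos M \<phi> - ext_neg M \<phi>)"
  "disbel (induced M) \<phi> = measure (pmeas M) (ext_neg M \<phi> - ext_pos M \<phi>)"
  "uncert (induced M) \<phi> = measure (pmeas M) (states M - (ext_pos M \<phi> \<union> ext_neg M \<phi>))"
  "conflict (induced M) \<phi> = measure (pmeas M) (ext_pos M \<phi> \<inter> ext_neg M \<phi>)"
  by (simp_all add: induced_def bel_def disbel_def uncert_def conflict_def)

lemma truth_prob_induced:
  assumes "prob_model M"
  shows "truth_prob (induced M) \<phi> = measure (pmeas M) (ext_pos M \<phi>)"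
proof -
  interpret prob_space "pmeas M" using assms by (simp add: prob_model_def)
  have "ext_pos M \<psi> \<in> events" "ext_neg M \<psi> \<in> events" for \<psi>
    using assms ext_subset_states[of M \<psi>] by (auto simp: prob_model_def)
  then show ?thesis
    using finite_measure_Diff'[of "ext_pos M \<phi>" "ext_neg M \<phi>"]
    by (simp add: induced_components)
qed

lemma soundness:
  assumes M: "prob_model M"
  shows "four_valued_axioms (induced M)"
proof -
  interpret prob_space "pmeas M" using M by (simp add: prob_model_def)
  note sp = ext_subset_states
  have ev: "ext_pos M \<psi> \<in> events" "ext_neg M \<psi> \<in> events" for \<psi>
    using M sp[of M \<psi>] by (auto simp: prob_model_def)
  have total: "bel (induced M) \<phi> + disbel (induced M) \<phi> + uncert (induced M) \<phi>
      + conflict (induced M) \<phi> = 1" for \<phi>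
  proof -
    have "states M = space (pmeas M)" using M by (simp add: prob_model_def)
    then have "uncert (induced M) \<phi> = 1 - prob (ext_pos M \<phi> \<union> ext_neg M \<phi>)"
      using prob_compl[of "ext_pos M \<phi> \<union> ext_neg M \<phi>"] ev by (simp add: induced_components)
    moreover have "prob (ext_pos M \<phi> \<union> ext_neg M \<phi>)
        = prob (ext_pos M \<phi>) + prob (ext_neg M \<phi> - ext_pos M \<phi>)"
      using finite_measure_Union'[of "ext_pos M \<phi>" "ext_neg M \<phi>"] ev by simp
    ultimately show ?thesis
      using truth_prob_induced[OF M, of \<phi>] by (simp add: induced_components)
  qed
  have mono: "truth_prob (induced M) \<phi> \<le> truth_prob (induced M) \<psi>" if "bd_entails \<phi> \<psi>" for \<phi> \<psi>
  proof -
    have "ext_pos M \<phi> \<subseteq> ext_pos M \<psi>"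
      using that by (auto simp: ext_pos_def bd_entails_def)
    then show ?thesis
      by (simp add: truth_prob_induced[OF M] finite_measure_mono ev)
  qed
  have modular: "truth_prob (induced M) \<phi> + truth_prob (induced M) \<psi>
      = truth_prob (induced M) (Conj \<phi> \<psi>) + truth_prob (induced M) (Disj \<phi> \<psi>)" for \<phi> \<psi>
    unfolding truth_prob_induced[OF M] ext_connectives
    using finite_measure_Union'[of "ext_pos M \<phi>" "ext_pos M \<psi>"]
      finite_measure_Diff'[of "ext_pos M \<psi>" "ext_pos M \<phi>"] ev
    by (simp add: Int_commute)
  have contra: "bel (induced M) (Conj \<phi> (Neg \<phi>)) = 0"
    "conflict (induced M) (Conj \<phi> (Neg \<phi>)) = conflict (induced M) \<phi>" for \<phi>
  proof -
    have "ext_pos M \<phi> \<inter> ext_neg M \<phi> - (ext_neg M \<phi> \<union> ext_pos M \<phi>) = {}"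
      "ext_pos M \<phi> \<inter> ext_neg M \<phi> \<inter> (ext_neg M \<phi> \<union> ext_pos M \<phi>) = ext_pos M \<phi> \<inter> ext_neg M \<phi>"
      by auto
    then show "bel (induced M) (Conj \<phi> (Neg \<phi>)) = 0"
      "conflict (induced M) (Conj \<phi> (Neg \<phi>)) = conflict (induced M) \<phi>"
      by (simp_all only: induced_components ext_connectives measure_empty)
  qed
  have neg: "bel (induced M) (Neg \<phi>) = disbel (induced M) \<phi>"
    "conflict (induced M) (Neg \<phi>) = conflict (induced M) \<phi>" for \<phi>
    by (simp_all add: induced_components ext_connectives Int_commute)
  have nonneg: "0 \<le> bel (induced M) \<phi>" "0 \<le> disbel (induced M) \<phi>"
    "0 \<le> uncert (induced M) \<phi>" "0 \<le> conflict (induced M) \<phi>" for \<phi>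
    by (simp_all add: induced_components)
  show ?thesis
    unfolding four_valued_axioms_def
    using nonneg total neg mono contra modular by (simp add: add.assoc)
qed

section \<open>Modular functions on the up-sets of a finite order\<close>

definition upset :: "'a::order set \<Rightarrow> bool" where
  "upset U \<longleftrightarrow> (\<forall>x\<in>U. \<forall>y\<ge>x. y \<in> U)"

lemma upset_atLeast: "upset {x..}" and upset_greaterThan: "upset {x<..}"
  by (auto simp: upset_def)

text \<open>If \<open>x\<close> is minimal in \<open>U\<close>, then \<open>U\<close> is the union of the up-sets \<open>{x..}\<close> and \<open>U - {x}\<close>, whose
  intersection is \<open>{x<..}\<close>. Hence modularity says that removing \<open>x\<close> from \<open>U\<close> costs
  \<open>m({x..}) - m({x<..})\<close>, whatever the rest of \<open>U\<close> is.\<close>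

lemma modular_upset_sum:
  fixes m :: "'a::order set \<Rightarrow> real"
  assumes empty: "m {} = 0"
    and modular: "\<And>U V. upset U \<Longrightarrow> upset V \<Longrightarrow> m (U \<union> V) + m (U \<inter> V) = m U + m V"
    and "finite U" "upset U"
  shows "m U = (\<Sum>x\<in>U. m {x..} - m {x<..})"
  using \<open>finite U\<close> \<open>upset U\<close>
proof (induction U rule: finite_psubset_induct)
  case (psubset U)
  show ?case
  proof (cases "U = {}")
    case True
    then show ?thesis by (simp add: empty)
  next
    case False
    then obtain x where x: "x \<in> U" "\<And>y. y \<in> U \<Longrightarrow> y \<le> x \<Longrightarrow> x = y"
      using finite_has_minimal[of U] psubset.hyps by metis
    have up: "upset (U - {x})"
      using psubset.prems x(2) unfolding upset_def by (metis Diff_iff singletonD singletonI x(1))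
    have "{x..} \<union> (U - {x}) = U" "{x..} \<inter> (U - {x}) = {x<..}"
      using psubset.prems x(1) by (auto simp: upset_def)
    then have "m U + m {x<..} = m {x..} + m (U - {x})"
      using modular[OF upset_atLeast up, of x] by simp
    moreover have "m (U - {x}) = (\<Sum>y\<in>U - {x}. m {y..} - m {y<..})"
      using psubset.IH[of "U - {x}"] up x(1) by blast
    ultimately show ?thesis
      using sum.remove[OF psubset.hyps x(1), of "\<lambda>y. m {y..} - m {y<..}"] by simp
  qed
qed

text \<open>The finite case of extending a valuation on a distributive lattice of sets to a measure.\<close>

lemma modular_upset_pmf:
  fixes m :: "'a::{finite,order} set \<Rightarrow> real"
  assumes empty: "m {} = 0" and one: "m UNIV = 1"
    and modular: "\<And>U V. upset U \<Longrightarrow> upset V \<Longrightarrow> m (U \<union> V) + m (U \<inter> V) = m U + m V"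
    and mono: "\<And>U V. upset U \<Longrightarrow> upset V \<Longrightarrow> U \<subseteq> V \<Longrightarrow> m U \<le> m V"
  shows "\<exists>q. \<forall>U. upset U \<longrightarrow> measure (measure_pmf q) U = m U"
proof -
  define f where "f x = m {x..} - m {x<..}" for x
  have sum_f: "m U = sum f U" if "upset U" for U
    unfolding f_def using modular_upset_sum[OF empty modular _ that] by simp
  have nonneg: "0 \<le> f x" for x
    unfolding f_def using mono[OF upset_greaterThan upset_atLeast, of x x] by force
  have "sum f UNIV = 1"
    using sum_f[of UNIV] one by (simp add: upset_def)
  then have "(\<integral>\<^sup>+ x. ennreal (f x) \<partial>count_space UNIV) = 1"
    by (simp add: nn_integral_count_space_finite nonneg)
  then have "pmf (embed_pmf f) x = f x" for x
    by (intro pmf_embed_pmf nonneg)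
  then have "measure (measure_pmf (embed_pmf f)) U = m U" if "upset U" for U
    by (simp add: measure_measure_pmf_finite sum_f[OF that])
  then show ?thesis by blast
qed

section \<open>Formulas as up-sets of signed atoms\<close>

text \<open>A state collects the signed atoms \<open>(p, True)\<close> with \<open>p\<close> supported as true and \<open>(p, False)\<close>
  with \<open>p\<close> supported as false. With this encoding the order on states is set inclusion.\<close>

definition truth_set :: "'p fm \<Rightarrow> ('p \<times> bool) set set" where
  "truth_set \<phi> = {s. supp_true (\<lambda>p. (p, True) \<in> s) (\<lambda>p. (p, False) \<in> s) \<phi>}"

lemma truth_set_Conj: "truth_set (Conj \<phi> \<psi>) = truth_set \<phi> \<inter> truth_set \<psi>"
  and truth_set_Disj: "truth_set (Disj \<phi> \<psi>) = truth_set \<phi> \<union> truth_set \<psi>"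
  by (auto simp: truth_set_def)

lemma bd_entails_iff_truth_set: "bd_entails \<phi> \<psi> \<longleftrightarrow> truth_set \<phi> \<subseteq> truth_set \<psi>"
proof
  assume sub: "truth_set \<phi> \<subseteq> truth_set \<psi>"
  show "bd_entails \<phi> \<psi>"
    unfolding bd_entails_def
  proof (intro allI impI)
    fix v w :: "'a \<Rightarrow> bool"
    assume "supp_true v w \<phi>"
    then have "{(p, b). if b then v p else w p} \<in> truth_set \<phi>"
      by (simp add: truth_set_def)
    then have "{(p, b). if b then v p else w p} \<in> truth_set \<psi>"
      using sub by blast
    then show "supp_true v w \<psi>"
      by (simp add: truth_set_def)
  qed
qed (auto simp: bd_entails_def truth_set_def)

lemma supp_mono:
  assumes "v \<le> v'" "w \<le> w'"
  shows "(supp_true v w \<phi> \<longrightarrow> supp_true v' w' \<phi>) \<and> (supp_false v w \<phi> \<longrightarrow> supp_false v' w' \<phi>)"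
  using assms by (induction \<phi>) (auto simp: le_fun_def)

lemma upset_truth_set: "upset (truth_set \<phi>)"
  unfolding upset_def
proof (intro ballI allI impI)
  fix s t assume "s \<in> truth_set \<phi>" "s \<le> t"
  then show "t \<in> truth_set \<phi>"
    using supp_mono[of "\<lambda>p. (p, True) \<in> s" "\<lambda>p. (p, True) \<in> t"
        "\<lambda>p. (p, False) \<in> s" "\<lambda>p. (p, False) \<in> t" \<phi>]
    by (auto simp: truth_set_def le_fun_def)
qed

text \<open>No formula is true in the state without signed atoms, and every formula is true in the state
  with all of them; so neither trivial up-set is definable.\<close>

lemma supp_empty: "\<not> supp_true (\<lambda>p. False) (\<lambda>p. False) \<phi> \<and> \<not> supp_false (\<lambda>p. False) (\<lambda>p. False) \<phi>"
  by (induction \<phi>) auto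

lemma supp_full: "supp_true (\<lambda>p. True) (\<lambda>p. True) \<phi> \<and> supp_false (\<lambda>p. True) (\<lambda>p. True) \<phi>"
  by (induction \<phi>) auto

lemma truth_set_nontrivial: "truth_set \<phi> \<noteq> {}" "truth_set \<phi> \<noteq> UNIV"
proof -
  have "UNIV \<in> truth_set \<phi>" "{} \<notin> truth_set \<phi>"
    using supp_full[of \<phi>] supp_empty[of \<phi>] by (simp_all add: truth_set_def)
  then show "truth_set \<phi> \<noteq> {}" "truth_set \<phi> \<noteq> UNIV" by auto
qed

lemma truth_set_INT:
  assumes "finite I" "I \<noteq> {}" "\<And>i. i \<in> I \<Longrightarrow> A i \<in> range truth_set"
  shows "(\<Inter>i\<in>I. A i) \<in> range truth_set"
  using assms
proof (induction I rule: finite_ne_induct)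
  case (insert i I)
  then obtain \<phi> \<psi> where "A i = truth_set \<phi>" "(\<Inter>i\<in>I. A i) = truth_set \<psi>"
    by (metis imageE insert_iff)
  then show ?case
    by (simp flip: truth_set_Conj)
qed simp

lemma truth_set_UN:
  assumes "finite I" "I \<noteq> {}" "\<And>i. i \<in> I \<Longrightarrow> A i \<in> range truth_set"
  shows "(\<Union>i\<in>I. A i) \<in> range truth_set"
  using assms
proof (induction I rule: finite_ne_induct)
  case (insert i I)
  then obtain \<phi> \<psi> where "A i = truth_set \<phi>" "(\<Union>i\<in>I. A i) = truth_set \<psi>"
    by (metis imageE insert_iff)
  then show ?case
    by (simp flip: truth_set_Disj)
qed simp

text \<open>Disjunctive normal form: \<open>U\<close> is the union of the principal up-sets of its members, and a
  principal up-set is the intersection of the truth sets of signed atoms. Properness of \<open>U\<close> keeps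
  these intersections from being empty conjunctions, and nonemptiness of \<open>U\<close> does it for the
  disjunction.\<close>

lemma truth_set_onto:
  fixes U :: "('p::finite \<times> bool) set set"
  assumes up: "upset U" and "U \<noteq> {}" "U \<noteq> UNIV"
  shows "U \<in> range truth_set"
proof -
  have literal: "{t. l \<in> t} \<in> range truth_set" for l :: "'p \<times> bool"
  proof (cases l)
    case (Pair p b)
    then have "{t. l \<in> t} = truth_set (if b then Atom p else Neg (Atom p))"
      by (auto simp: truth_set_def)
    then show ?thesis by blast
  qed
  have principal: "{s..} \<in> range truth_set" if "s \<in> U" for s
  proof -
    have "s \<noteq> {}"
      using that up \<open>U \<noteq> UNIV\<close> by (auto simp: upset_def)
    then have "(\<Inter>l\<in>s. {t. l \<in> t}) \<in> range truth_set"
      by (intro truth_set_INT literal) auto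
    moreover have "{s..} = (\<Inter>l\<in>s. {t. l \<in> t})" by auto
    ultimately show ?thesis by simp
  qed
  have "U = (\<Union>s\<in>U. {s..})"
    using up by (auto simp: upset_def)
  moreover have "(\<Union>s\<in>U. {s..}) \<in> range truth_set"
    using \<open>U \<noteq> {}\<close> principal by (intro truth_set_UN) auto
  ultimately show ?thesis by simp
qed

section \<open>Completeness\<close>

lemma axioms_truth_prob:
  assumes "four_valued_axioms P"
  shows "0 \<le> truth_prob P \<phi>" "truth_prob P \<phi> \<le> 1"
    and "truth_set \<phi> \<subseteq> truth_set \<psi> \<Longrightarrow> truth_prob P \<phi> \<le> truth_prob P \<psi>"
    and "truth_prob P \<phi> + truth_prob P \<psi> = truth_prob P (Conj \<phi> \<psi>) + truth_prob P (Disj \<phi> \<psi>)"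
proof -
  have ax: "0 \<le> bel P \<phi>" "0 \<le> disbel P \<phi>" "0 \<le> uncert P \<phi>" "0 \<le> conflict P \<phi>"
    "bel P \<phi> + disbel P \<phi> + uncert P \<phi> + conflict P \<phi> = 1"
    using assms by (auto simp: four_valued_axioms_def)
  show "0 \<le> truth_prob P \<phi>" "truth_prob P \<phi> \<le> 1" using ax by linarith+
  show "truth_prob P \<phi> \<le> truth_prob P \<psi>" if "truth_set \<phi> \<subseteq> truth_set \<psi>"
    using assms that by (simp add: four_valued_axioms_def bd_entails_iff_truth_set)
  show "truth_prob P \<phi> + truth_prob P \<psi> = truth_prob P (Conj \<phi> \<psi>) + truth_prob P (Disj \<phi> \<psi>)"
  proof -
    have "bel P \<phi> + conflict P \<phi> + bel P \<psi> + conflict P \<psi> =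
        bel P (Conj \<phi> \<psi>) + conflict P (Conj \<phi> \<psi>) + bel P (Disj \<phi> \<psi>) + conflict P (Disj \<phi> \<psi>)"
      using assms unfolding four_valued_axioms_def by blast
    then show ?thesis by linarith
  qed
qed

lemma axioms_give_pmf:
  fixes P :: "('p::finite) four_fun"
  assumes P: "four_valued_axioms P"
  shows "\<exists>q. \<forall>\<phi>. measure (measure_pmf q) (truth_set \<phi>) = truth_prob P \<phi>"
proof -
  note ax = axioms_truth_prob[OF P]
  define m where "m U = (if U = {} then 0 else if U = UNIV then 1
    else truth_prob P (SOME \<phi>. truth_set \<phi> = U))" for U
  have m_truth_set: "m (truth_set \<phi>) = truth_prob P \<phi>" for \<phi>
  proof -
    have "truth_set (SOME \<psi>. truth_set \<psi> = truth_set \<phi>) = truth_set \<phi>"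
      by (rule someI) simp
    then show ?thesis
      using ax(3) by (simp add: m_def truth_set_nontrivial order_antisym)
  qed
  have cases: "U = {} \<or> U = UNIV \<or> (\<exists>\<phi>. U = truth_set \<phi>)" if "upset U" for U :: "('p \<times> bool) set set"
    using truth_set_onto[OF that] by blast
  have m_trivial: "m {} = 0" "m UNIV = 1" by (simp_all add: m_def)
  have range: "0 \<le> m U" "m U \<le> 1" if "upset U" for U
    using cases[OF that] ax(1,2) by (auto simp: m_trivial m_truth_set)
  have mono: "m U \<le> m V" if "upset U" "upset V" "U \<subseteq> V" for U V
  proof (cases "U = {} \<or> V = UNIV")
    case True
    then show ?thesis using range that by (auto simp: m_trivial)
  next
    case False
    then have "V \<noteq> {}" "U \<noteq> UNIV" using that(3) by auto
    with False obtain \<phi> \<psi> where "U = truth_set \<phi>" "V = truth_set \<psi>"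
      using cases \<open>upset U\<close> \<open>upset V\<close> by metis
    then show ?thesis using ax(3) that(3) by (simp add: m_truth_set)
  qed
  have modular: "m (U \<union> V) + m (U \<inter> V) = m U + m V" if "upset U" "upset V" for U V
  proof (cases "U = {} \<or> U = UNIV \<or> V = {} \<or> V = UNIV")
    case False
    then obtain \<phi> \<psi> where "U = truth_set \<phi>" "V = truth_set \<psi>"
      using cases \<open>upset U\<close> \<open>upset V\<close> by metis
    then show ?thesis
      using ax(4)[of \<phi> \<psi>] by (simp add: m_truth_set flip: truth_set_Conj truth_set_Disj)
  qed auto
  show ?thesis
    using modular_upset_pmf[of m, OF m_trivial modular mono] upset_truth_set m_truth_set by metis
qed

text \<open>Two functions that satisfy the axioms agree as soon as their truth probabilities do: \<open>b + c\<close>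
  at \<open>\<phi> \<and> \<not>\<phi>\<close> is \<open>c\<close>, and at \<open>\<not>\<phi>\<close> it is \<open>d + c\<close>.\<close>

lemma axioms_determined_by_truth_prob:
  assumes P: "four_valued_axioms P" and Q: "four_valued_axioms Q"
    and eq: "\<And>\<phi>. truth_prob P \<phi> = truth_prob Q \<phi>"
  shows "P = Q"
proof
  fix \<phi>
  have c: "conflict P \<phi> = conflict Q \<phi>"
    using P Q eq[of "Conj \<phi> (Neg \<phi>)"] by (simp add: four_valued_axioms_def)
  have b: "bel P \<phi> = bel Q \<phi>"
    using eq[of \<phi>] c by simp
  have d: "disbel P \<phi> = disbel Q \<phi>"
    using P Q eq[of "Neg \<phi>"] c by (simp add: four_valued_axioms_def)
  have "bel P \<phi> + disbel P \<phi> + uncert P \<phi> + conflict P \<phi> = 1"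
    "bel Q \<phi> + disbel Q \<phi> + uncert Q \<phi> + conflict Q \<phi> = 1"
    using P Q by (auto simp: four_valued_axioms_def)
  then have "uncert P \<phi> = uncert Q \<phi>"
    using b c d by linarith
  with b c d show "P \<phi> = Q \<phi>"
    by (simp add: bel_def disbel_def uncert_def conflict_def split: prod.splits)
qed

lemma completeness:
  fixes P :: "('p::finite) four_fun"
  assumes P: "four_valued_axioms P"
  shows "\<exists>M :: (nat, 'p) pmodel. prob_model M \<and> induced M = P"
proof -
  obtain q where q: "\<And>\<phi>. measure (measure_pmf q) (truth_set \<phi>) = truth_prob P \<phi>"
    using axioms_give_pmf[OF P] by blast
  obtain code :: "('p \<times> bool) set \<Rightarrow> nat" where code: "inj code"
    using finite_imp_inj_to_nat_seg[of "UNIV :: ('p \<times> bool) set set"] by auto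
  \<comment> \<open>All of \<^typ>\<open>nat\<close> serves as the set of states; numbers that code no state get measure zero.\<close>
  define M :: "(nat, 'p) pmodel" where
    "M = \<lparr>states = UNIV, pmeas = measure_pmf (map_pmf code q),
      vpos = (\<lambda>n p. (p, True) \<in> inv code n), vneg = (\<lambda>n p. (p, False) \<in> inv code n)\<rparr>"
  have M: "prob_model M"
    by (simp add: prob_model_def M_def measure_pmf.prob_space_axioms)
  have "code -` ext_pos M \<phi> = truth_set \<phi>" for \<phi>
    using code by (auto simp: M_def ext_pos_def truth_set_def)
  then have "truth_prob (induced M) \<phi> = truth_prob P \<phi>" for \<phi>
    using q by (simp add: truth_prob_induced[OF M]) (simp add: M_def)
  then have "induced M = P"
    by (intro axioms_determined_by_truth_prob soundness M P)
  with M show ?thesis by blast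
qed

theorem corollary2:
  fixes P :: "('p::finite) four_fun"
  shows "(four_valued_axioms P \<longleftrightarrow>
            (\<exists>M :: (nat, 'p) pmodel. prob_model M \<and> induced M = P)) \<and>
         (\<forall>M :: ('s, 'p) pmodel. prob_model M \<longrightarrow> four_valued_axioms (induced M))"
proof (intro conjI iffI allI impI)
  assume "four_valued_axioms P"
  then show "\<exists>M :: (nat, 'p) pmodel. prob_model M \<and> induced M = P"
    by (rule completeness)
next
  assume "\<exists>M :: (nat, 'p) pmodel. prob_model M \<and> induced M = P"
  then show "four_valued_axioms P"
    using soundness by blast
qed (rule soundness)

end
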